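(* Let $f(x)=\frac1n\sum_{i=1}^n f_i(x)$ with $f_i(x)=\frac12 x^\top A_i x-b_i^\top x$, where $A_i\in\mathbb{R}^{d\times d}$ is symmetric positive semidefinite and $b_i\in\mathbb{R}^d$, the $A_i$ not all zero ($f$ is convex but need not be strongly convex). Assume there is $x_*$ with $\nabla f_i(x_* )=0$ for all $i$ (interpolation). Fix any $\gamma>0$ and $S\in\{1,\dots,n\}$, and let $(x_k)$ be the iterates of FedExProx with $S$-nice sampling, started at $x_0\in\mathbb{R}^d$, with $\alpha_k=\alpha(x_k,\mathcal{S}_k)$ given by one of the two rules below. Write $\inf\alpha=\inf\{\alpha(x,\mathcal{S}):x\in\mathbb{R}^d,\ \mathcal{S}\subseteq\{1,\dots,n\},\ |\mathcal{S}|=S\}$. 1. (FedExProx-GraDS) If $$\alpha(x,\mathcal{S})=\frac{\frac1S\sum_{i\in\mathcal{S}}\|\nabla M^\gamma_{f_i}(x)\|^2}{\left\|\frac1S\sum_{i\in\mathcal{S}}\nabla M^\gamma_{f_i}(x)\right\|^2},$$ then $\alpha(x,\mathcal S)\ge1$ and for all $K\ge0$ $$\mathbb{E}\big[\|x_K-\Pi(x_K)\|^2\big]\le\left(1-\inf\alpha\cdot\gamma\,\frac{2+\gamma L_{\max}}{1+\gamma L_{\max}}\,\lambda_{\min}^+(\gamma)\right)^K\|x_0-\Pi(x_0)\|^2 .$$ 2. (FedExProx-StoPS) If $$\alpha(x,\mathcal{S})=\frac{\frac1S\sum_{i\in\mathcal{S}}\big(M^\gamma_{f_i}(x)-\inf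 M^\gamma_{f_i}\big)}{\gamma\left\|\frac1S\sum_{i\in\mathcal{S}}\nabla M^\gamma_{f_i}(x)\right\|^2},$$ then for all $K\ge0$ $$\mathbb{E}\big[\|x_K-\Pi(x_K)\|^2\big]\le\left(1-\frac32\inf\alpha\cdot\gamma\,\lambda_{\min}^+(\gamma)\right)^K\|x_0-\Pi(x_0)\|^2 .$$
   Context: For a convex function $g$ and $\gamma>0$, $\mathrm{prox}_{\gamma g}(x)=\arg\min_z\{g(z)+\frac1{2\gamma}\|z-x\|^2\}$ and $M_g^\gamma(x)=\min_z\{g(z)+\frac1{2\gamma}\|z-x\|^2\}$ (Moreau envelope), with $\nabla M_g^\gamma(x)=\frac1\gamma(x-\mathrm{prox}_{\gamma g}(x))$. $\lambda_{\min}^+(\gamma)$ is the smallest non-zero eigenvalue of $M=\frac1n\sum_i\frac1\gamma(I-(\gamma A_i+I)^{-1})$ and $L_{\max}=\max_i\lambda_{\max}(A_i)$. FedExProx with $S$-nice sampling: at each iteration $k$ sample, independently of the past, a subset $\mathcal{S}_k\subseteq\{1,\dots,n\}$ uniformly from all subsets of cardinality $S$, and set $x_{k+1}=x_k+\alpha_k\big(\frac1S\sum_{i\in\mathcal{S}_k}\mathrm{prox}_{\gamma f_i}(x_k)-x_k\big)$. Convention: $\alpha(x,\mathcal{S})$ is considered (and the infimum taken) only over pairs for which its denominator is non-zero; if the denominator vanishes at $(x_k,\mathcal{S}_k)$ then the averaged step direction is zero and $x_{k+1}=x_k$. $\mathcal{X}_*=\{x:\nabla f_i(x)=0\ \forall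 i\}$ and $\Pi$ is the Euclidean projection onto $\mathcal{X}_*$. *)

theory Defs
  imports "HOL-Probability.Probability"
begin

section \<open>Matrices\<close>

definition sym_psd :: "real^'d^'d \<Rightarrow> bool" where
  "sym_psd A \<longleftrightarrow> transpose A = A \<and> (\<forall>x. 0 \<le> x \<bullet> (A *v x))"

definition eigenvalue :: "real^'d^'d \<Rightarrow> real \<Rightarrow> bool" where
  "eigenvalue A \<mu> \<longleftrightarrow> (\<exists>v. v \<noteq> 0 \<and> A *v v = \<mu> *\<^sub>R v)"

definition lambda_max :: "real^'d^'d \<Rightarrow> real" where
  "lambda_max A = Max {\<mu>. eigenvalue A \<mu>}"

definition lambda_min_nonzero :: "real^'d^'d \<Rightarrow> real" where
  "lambda_min_nonzero A = Min {\<mu>. eigenvalue A \<mu> \<and> \<mu> \<noteq> 0}"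

definition L_max :: "nat \<Rightarrow> (nat \<Rightarrow> real^'d^'d) \<Rightarrow> real" where
  "L_max n A = (MAX i\<in>{1..n}. lambda_max (A i))"

definition M_matrix :: "nat \<Rightarrow> (nat \<Rightarrow> real^'d^'d) \<Rightarrow> real \<Rightarrow> real^'d^'d" where
  "M_matrix n A \<gamma> =
     (1 / real n) *\<^sub>R (\<Sum>i=1..n. (1 / \<gamma>) *\<^sub>R (mat 1 - matrix_inv (\<gamma> *\<^sub>R A i + mat 1)))"

section \<open>Gradients, proximal operators and Moreau envelopes\<close>

text \<open>The value of \<open>grad h x\<close> is meaningful only where \<open>h\<close> is differentiable; the gradient
  is then unique.\<close>

definition grad :: "('a::real_inner \<Rightarrow> real) \<Rightarrow> 'a \<Rightarrow> 'a" where
  "grad h x = (THE D. GDERIV h x :> D)"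

definition prox :: "real \<Rightarrow> ('a::real_inner \<Rightarrow> real) \<Rightarrow> 'a \<Rightarrow> 'a" where
  "prox \<gamma> g x = arg_min (\<lambda>z. g z + 1 / (2 * \<gamma>) * (norm (z - x))\<^sup>2) (\<lambda>_. True)"

text \<open>For convex \<open>g\<close> on a Euclidean space and \<open>\<gamma> > 0\<close> the infimum is attained, at
  \<open>prox \<gamma> g x\<close>. (The library constant \<open>Min\<close> is for finite sets only.)\<close>

definition moreau :: "real \<Rightarrow> ('a::real_inner \<Rightarrow> real) \<Rightarrow> 'a \<Rightarrow> real" where
  "moreau \<gamma> g x = (INF z. g z + 1 / (2 * \<gamma>) * (norm (z - x))\<^sup>2)"

section \<open>FedExProx with nice sampling\<close>

definition solutions :: "nat \<Rightarrow> (nat \<Rightarrow> 'a::real_inner \<Rightarrow> real) \<Rightarrow> 'a set" where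
  "solutions n f = {x. \<forall>i\<in>{1..n}. grad (f i) x = 0}"

definition nice_sets :: "nat \<Rightarrow> nat \<Rightarrow> nat set set" where
  "nice_sets n S = {T. T \<subseteq> {1..n} \<and> card T = S}"

definition nice_sampling :: "nat \<Rightarrow> nat \<Rightarrow> 'w measure \<Rightarrow> (nat \<Rightarrow> 'w \<Rightarrow> nat set) \<Rightarrow> bool" where
  "nice_sampling n S P \<S> \<longleftrightarrow>
     prob_space P \<and>
     prob_space.indep_vars P (\<lambda>_. count_space (nice_sets n S)) \<S> UNIV \<and>
     (\<forall>k. distr P (count_space (nice_sets n S)) (\<S> k) = uniform_count_measure (nice_sets n S))"

text \<open>The argument \<open>\<alpha>\<close> is the step-size rule \<open>\<alpha>(x, T)\<close>, \<open>Ts\<close> the realised sequence of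
  sampled sets.\<close>

primrec fedexprox ::
  "real \<Rightarrow> nat \<Rightarrow> (nat \<Rightarrow> 'a::real_inner \<Rightarrow> real) \<Rightarrow> ('a \<Rightarrow> nat set \<Rightarrow> real) \<Rightarrow> 'a
    \<Rightarrow> (nat \<Rightarrow> nat set) \<Rightarrow> nat \<Rightarrow> 'a" where
  "fedexprox \<gamma> S f \<alpha> x0 Ts 0 = x0"
| "fedexprox \<gamma> S f \<alpha> x0 Ts (Suc k) =
     (let x = fedexprox \<gamma> S f \<alpha> x0 Ts k; T = Ts k
      in x + \<alpha> x T *\<^sub>R ((1 / real S) *\<^sub>R (\<Sum>i\<in>T. prox \<gamma> (f i) x) - x))"

definition avg_moreau_grad ::
  "real \<Rightarrow> nat \<Rightarrow> (nat \<Rightarrow> 'a::real_inner \<Rightarrow> real) \<Rightarrow> 'a \<Rightarrow> nat set \<Rightarrow> 'a" where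
  "avg_moreau_grad \<gamma> S f x T = (1 / real S) *\<^sub>R (\<Sum>i\<in>T. grad (moreau \<gamma> (f i)) x)"

definition grads_step ::
  "real \<Rightarrow> nat \<Rightarrow> (nat \<Rightarrow> 'a::real_inner \<Rightarrow> real) \<Rightarrow> 'a \<Rightarrow> nat set \<Rightarrow> real" where
  "grads_step \<gamma> S f x T =
     ((1 / real S) * (\<Sum>i\<in>T. (norm (grad (moreau \<gamma> (f i)) x))\<^sup>2))
       / (norm (avg_moreau_grad \<gamma> S f x T))\<^sup>2"

definition stops_step ::
  "real \<Rightarrow> nat \<Rightarrow> (nat \<Rightarrow> 'a::real_inner \<Rightarrow> real) \<Rightarrow> 'a \<Rightarrow> nat set \<Rightarrow> real" where
  "stops_step \<gamma> S f x T =
     ((1 / real S) * (\<Sum>i\<in>T. moreau \<gamma> (f i) x - (INF z. moreau \<gamma> (f i) z)))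
       / (\<gamma> * (norm (avg_moreau_grad \<gamma> S f x T))\<^sup>2)"

text \<open>For \<open>\<gamma> > 0\<close> the denominators of both step-size rules vanish exactly where the averaged
  gradient does. Such pairs are left out of the infimum. In the iteration they give
  \<open>\<alpha> = 0\<close>, since \<open>a / 0 = 0\<close>, and hence \<open>x\<^sub>k\<^sub>+\<^sub>1 = x\<^sub>k\<close>.\<close>

definition inf_step ::
  "real \<Rightarrow> nat \<Rightarrow> nat \<Rightarrow> (nat \<Rightarrow> 'a::real_inner \<Rightarrow> real) \<Rightarrow> ('a \<Rightarrow> nat set \<Rightarrow> real) \<Rightarrow> real" where
  "inf_step \<gamma> n S f \<alpha> =
     Inf {\<alpha> x T | x T. T \<in> nice_sets n S \<and> avg_moreau_grad \<gamma> S f x T \<noteq> 0}"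

end

theory Submission
  imports Defs
begin

text \<open>
  Put \<open>y = x - \<Pi>(x)\<close> and \<open>Q\<^sub>i = (I - (\<gamma> A\<^sub>i + I)\<inverse>) / \<gamma>\<close>, the Yosida approximation of \<open>A\<^sub>i\<close>. Under
  interpolation \<open>\<nabla>M\<^sub>i(x) = Q\<^sub>i y\<close> and \<open>M\<^sub>i(x) - inf M\<^sub>i = (y \<bullet> Q\<^sub>i y) / 2\<close>, so a step replaces \<open>y\<close> by
  \<open>y - \<alpha> \<gamma> g\<close>, where \<open>g\<close> averages \<open>Q\<^sub>i y\<close> over the sample. Both step sizes are chosen so that
  \<open>\<gamma> \<alpha> |g|\<^sup>2\<close> is at most \<open>2 - c\<close> times the sampled average \<open>e\<close> of \<open>y \<bullet> Q\<^sub>i y\<close>: for GraDS,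
  \<open>|Q\<^sub>i y|\<^sup>2 \<le> L / (1 + \<gamma> L) (y \<bullet> Q\<^sub>i y)\<close> gives \<open>c = (2 + \<gamma> L) / (1 + \<gamma> L)\<close>; for StoPS, \<open>c = 3/2\<close>.
  Hence the squared distance drops by at least \<open>\<alpha> \<gamma> c e\<close>. Averaging over the sample turns \<open>e\<close>
  into \<open>y \<bullet> M y\<close>, and since \<open>y\<close> is orthogonal to the kernel of \<open>M\<close> (the directions of the solution
  set), the Rayleigh principle bounds this below by \<open>\<lambda>\<^sub>m\<^sub>i\<^sub>n\<^sup>+ |y|\<^sup>2\<close>.
\<close>

section \<open>Symmetric matrices and Rayleigh quotients\<close>

lemma symmetric_inner_commute:
  fixes A :: "real^'d^'d"
  assumes "transpose A = A"
  shows "x \<bullet> (A *v y) = (A *v x) \<bullet> y"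
  by (metis assms dot_lmul_matrix transpose_matrix_vector)

lemma sym_psdI:
  fixes A :: "real^'d^'d"
  assumes "\<And>x y. x \<bullet> (A *v y) = (A *v x) \<bullet> y" "\<And>x. 0 \<le> x \<bullet> (A *v x)"
  shows "sym_psd A"
proof -
  have "transpose A *v x = A *v x" for x
  proof -
    have "(transpose A *v x) \<bullet> y = (A *v x) \<bullet> y" for y
      using assms(1)[of x y] by (simp add: transpose_matrix_vector dot_lmul_matrix)
    then show ?thesis
      by (metis vector_eq_rdot)
  qed
  then show ?thesis
    using assms(2) by (simp add: sym_psd_def matrix_eq)
qed

text \<open>The form is nonnegative on the span of \<open>x\<close> and \<open>y\<close>, so its
  discriminant there is nonpositive. Positivity is asked on a subspace because the Rayleigh argument
  below applies this to a shifted matrix that is nonnegative on \<open>V\<close>.\<close>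

lemma psd_cauchy_schwarz_on:
  fixes A :: "real^'d^'d"
  assumes sym: "transpose A = A" and V: "subspace V"
    and psd: "\<And>x. x \<in> V \<Longrightarrow> 0 \<le> x \<bullet> (A *v x)"
    and x: "x \<in> V" and y: "y \<in> V"
  shows "(x \<bullet> (A *v y))\<^sup>2 \<le> (x \<bullet> (A *v x)) * (y \<bullet> (A *v y))"
proof -
  define a b c where "a = x \<bullet> (A *v x)" and "b = x \<bullet> (A *v y)" and "c = y \<bullet> (A *v y)"
  have sym': "y \<bullet> (A *v x) = b"
    using symmetric_inner_commute[OF sym] by (metis b_def inner_commute)
  have nonneg: "0 \<le> s\<^sup>2 * a + 2 * s * t * b + t\<^sup>2 * c" for s t
  proof -
    have "s *\<^sub>R x + t *\<^sub>R y \<in> V"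
      using V x y by (simp add: subspace_add subspace_scale)
    from psd[OF this] show ?thesis
      by (simp add: a_def c_def sym' flip: b_def
          add: matrix_vector_right_distrib matrix_vector_mult_scaleR inner_add_left inner_add_right
            algebra_simps power2_eq_square)
  qed
  have ac: "0 \<le> a" "0 \<le> c"
    using psd x y by (auto simp: a_def c_def)
  have "b\<^sup>2 \<le> a * c"
  proof (cases "a = 0")
    case True
    have "b = 0"
    proof (rule ccontr)
      assume "b \<noteq> 0"
      \<comment> \<open>With \<open>a = 0\<close> and \<open>t = 1\<close> the form is affine in
        \<open>s\<close>, and this \<open>s\<close> gives it the value -1.\<close>
      then show False
        using nonneg[of "- (c + 1) / (2 * b)" 1] True by (simp add: field_simps)
    qed
    then show ?thesis using True by simp
  next
    case False
    \<comment> \<open>The pair \<open>s = - b\<close>, \<open>t = a\<close> is, up to scaling, the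
      minimiser of the form.\<close>
    have "0 \<le> a * (a * c - b\<^sup>2)"
      using nonneg[of "- b" a] by (simp add: algebra_simps power2_eq_square)
    then show ?thesis
      using False ac by (simp add: zero_le_mult_iff)
  qed
  then show ?thesis by (simp add: a_def b_def c_def)
qed

text \<open>Compactness of the unit sphere of \<open>V\<close> gives a minimiser \<open>v\<close> of
  the quadratic form, with value \<mu>. The form of \<open>A - \<mu> I\<close> is then nonnegative
  on \<open>V\<close> and zero at \<open>v\<close>, which by Cauchy-Schwarz forces \<open>v\<close>
  into the kernel of \<open>A - \<mu> I\<close>.\<close>

lemma symmetric_rayleigh_minimum:
  fixes A :: "real^'d^'d"
  assumes sym: "transpose A = A" and V: "subspace V" and "V \<noteq> {0}"
    and inv: "\<And>x. x \<in> V \<Longrightarrow> A *v x \<in> V"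
  obtains v \<mu> where "v \<in> V" "v \<noteq> 0" "A *v v = \<mu> *\<^sub>R v"
    "\<And>x. x \<in> V \<Longrightarrow> \<mu> * (norm x)\<^sup>2 \<le> x \<bullet> (A *v x)"
proof -
  define K where "K = V \<inter> sphere 0 1"
  obtain w where w: "w \<in> V" "w \<noteq> 0"
    using \<open>V \<noteq> {0}\<close> V subspace_0 by blast
  then have "(1 / norm w) *\<^sub>R w \<in> K"
    using V by (simp add: K_def subspace_scale)
  moreover have "compact K"
    unfolding K_def using closed_subspace[OF V] by (simp add: closed_Int_compact)
  moreover have "continuous_on K (\<lambda>x. x \<bullet> (A *v x))"
    by (intro continuous_intros matrix_vector_mult_linear_continuous_on)
  ultimately obtain v where v: "v \<in> K" "\<And>x. x \<in> K \<Longrightarrow> v \<bullet> (A *v v) \<le> x \<bullet> (A *v x)"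
    using continuous_attains_inf[of K "\<lambda>x. x \<bullet> (A *v x)"] by blast
  define \<mu> where "\<mu> = v \<bullet> (A *v v)"
  have vV: "v \<in> V" and nv: "norm v = 1"
    using v(1) by (auto simp: K_def)
  have le: "\<mu> * (norm x)\<^sup>2 \<le> x \<bullet> (A *v x)" if "x \<in> V" for x
  proof (cases "x = 0")
    case False
    have "(1 / norm x) *\<^sub>R x \<in> K"
      using V False that by (simp add: K_def subspace_scale)
    from v(2)[OF this] show ?thesis
      using False by (simp add: \<mu>_def matrix_vector_mult_scaleR field_simps power2_eq_square)
  qed simp
  define C where "C = A - \<mu> *\<^sub>R mat 1"
  have Cv: "C *v x = A *v x - \<mu> *\<^sub>R x" for x
    by (simp add: C_def matrix_vector_mult_diff_rdistrib flip: scaleR_matrix_vector_assoc)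
  have "transpose C = C"
    using sym by (simp add: C_def vec_eq_iff transpose_def mat_def)
  moreover have "0 \<le> x \<bullet> (C *v x)" if "x \<in> V" for x
    using le[OF that] by (simp add: Cv inner_diff_right power2_norm_eq_inner)
  moreover have CV: "C *v v \<in> V"
    using vV inv V by (simp add: Cv subspace_diff subspace_scale)
  \<comment> \<open>Cauchy-Schwarz for the pair \<open>C *v v\<close> and \<open>v\<close>, both in
    \<open>V\<close>: the left side is the fourth power of the norm of \<open>C *v v\<close>, and
    the last factor on the right vanishes.\<close>
  ultimately have "((C *v v) \<bullet> (C *v v))\<^sup>2 \<le> ((C *v v) \<bullet> (C *v (C *v v))) * (v \<bullet> (C *v v))"
    using psd_cauchy_schwarz_on[OF _ V] vV by blast
  moreover have "v \<bullet> (C *v v) = 0"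
    using nv by (simp add: Cv inner_diff_right \<mu>_def flip: power2_norm_eq_inner)
  ultimately have "A *v v = \<mu> *\<^sub>R v"
    by (simp add: Cv)
  with that[OF vV] nv le show thesis
    by fastforce
qed

text \<open>Eigenvectors of distinct eigenvalues are orthogonal, and an orthogonal set in finite
  dimension is finite. This is what makes the \<open>Max\<close> and \<open>Min\<close> over
  eigenvalues meaningful.\<close>

lemma finite_eigenvalues:
  fixes A :: "real^'d^'d"
  assumes sym: "transpose A = A"
  shows "finite {\<mu>. eigenvalue A \<mu>}"
proof -
  define e where "e \<mu> = (SOME v. v \<noteq> 0 \<and> A *v v = \<mu> *\<^sub>R v)" for \<mu>
  have e: "e \<mu> \<noteq> 0" "A *v e \<mu> = \<mu> *\<^sub>R e \<mu>" if "eigenvalue A \<mu>" for \<mu>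
    using someI_ex[of "\<lambda>v. v \<noteq> 0 \<and> A *v v = \<mu> *\<^sub>R v"] that
    by (auto simp: e_def eigenvalue_def)
  have orth: "e \<mu> \<bullet> e \<nu> = 0" if "eigenvalue A \<mu>" "eigenvalue A \<nu>" "\<mu> \<noteq> \<nu>" for \<mu> \<nu>
    using symmetric_inner_commute[OF sym, of "e \<mu>" "e \<nu>"] e that by simp
  have "pairwise orthogonal (e ` {\<mu>. eigenvalue A \<mu>})"
    unfolding pairwise_def orthogonal_def using orth by fastforce
  then have "finite (e ` {\<mu>. eigenvalue A \<mu>})"
    by (rule pairwise_orthogonal_imp_finite)
  moreover have "inj_on e {\<mu>. eigenvalue A \<mu>}"
    using e orth by (intro inj_onI) (metis inner_eq_zero_iff mem_Collect_eq)
  ultimately show ?thesis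
    by (rule finite_imageD)
qed

text \<open>The Rayleigh minimum of \<open>- A\<close> over the whole space is the negative of an
  eigenvalue of \<open>A\<close>.\<close>

lemma inner_mult_le_lambda_max:
  fixes A :: "real^'d^'d"
  assumes sym: "transpose A = A"
  shows "x \<bullet> (A *v x) \<le> lambda_max A * (norm x)\<^sup>2"
proof -
  have neg: "(- A) *v y = - (A *v y)" for y
    by (simp add: vec_eq_iff matrix_vector_mult_def sum_negf)
  have "transpose (- A) = - A"
    using sym by (simp add: vec_eq_iff transpose_def)
  moreover have "(UNIV :: (real^'d) set) \<noteq> {0}"
    by (metis UNIV_I singletonD axis_eq_0_iff zero_neq_one)
  ultimately obtain v \<mu> where v: "v \<noteq> 0" "(- A) *v v = \<mu> *\<^sub>R v"
    and le: "\<And>x. \<mu> * (norm x)\<^sup>2 \<le> x \<bullet> ((- A) *v x)"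
    using symmetric_rayleigh_minimum[of "- A" UNIV] by auto
  have "eigenvalue A (- \<mu>)"
    using v unfolding eigenvalue_def neg by (metis minus_equation_iff scaleR_minus_left)
  then have "- \<mu> \<le> lambda_max A"
    unfolding lambda_max_def using finite_eigenvalues[OF sym] by (intro Max_ge) auto
  then have "- \<mu> * (norm x)\<^sup>2 \<le> lambda_max A * (norm x)\<^sup>2"
    by (intro mult_right_mono) auto
  with le[of x] show ?thesis
    by (simp add: neg)
qed

text \<open>The orthogonal complement \<open>V\<close> of the kernel is invariant under the
  symmetric \<open>A\<close>, so the Rayleigh minimum over \<open>V\<close> is an eigenvalue. It is
  nonzero, since otherwise its eigenvector would lie in the kernel and be orthogonal to
  itself.\<close>

lemma lambda_min_nonzero_le_inner:
  fixes A :: "real^'d^'d"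
  assumes sym: "transpose A = A" and orth: "\<And>v. A *v v = 0 \<Longrightarrow> x \<bullet> v = 0"
  shows "lambda_min_nonzero A * (norm x)\<^sup>2 \<le> x \<bullet> (A *v x)"
proof (cases "x = 0")
  case False
  define V where "V = {y. \<forall>v. A *v v = 0 \<longrightarrow> y \<bullet> v = 0}"
  have "subspace V"
    by (auto simp: V_def subspace_def inner_add_left)
  moreover have "x \<in> V"
    using orth by (simp add: V_def)
  moreover have "A *v y \<in> V" for y
    by (simp add: V_def flip: symmetric_inner_commute[OF sym])
  ultimately obtain v \<mu> where v: "v \<in> V" "v \<noteq> 0" "A *v v = \<mu> *\<^sub>R v"
    and le: "\<And>x. x \<in> V \<Longrightarrow> \<mu> * (norm x)\<^sup>2 \<le> x \<bullet> (A *v x)"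
    using symmetric_rayleigh_minimum[OF sym, of V] False by blast
  have "\<mu> \<noteq> 0"
    using v by (auto simp: V_def)
  with v have "lambda_min_nonzero A \<le> \<mu>"
    unfolding lambda_min_nonzero_def
    by (intro Min_le finite_subset[OF _ finite_eigenvalues[OF sym]]) (auto simp: eigenvalue_def)
  then have "lambda_min_nonzero A * (norm x)\<^sup>2 \<le> \<mu> * (norm x)\<^sup>2"
    by (intro mult_right_mono) auto
  with le[OF \<open>x \<in> V\<close>] show ?thesis by simp
qed simp

section \<open>Moreau envelopes of quadratics\<close>

text \<open>The summand of \<open>M_matrix\<close>. For positive semidefinite \<open>A\<close> and
  \<gamma> > 0 it is the product of \<open>A\<close> with its resolvent, and the Hessian of the
  Moreau envelope of a quadratic with matrix \<open>A\<close>.\<close>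

definition yosida :: "real \<Rightarrow> real^'d^'d \<Rightarrow> real^'d^'d" where
  "yosida \<gamma> A = (1 / \<gamma>) *\<^sub>R (mat 1 - matrix_inv (\<gamma> *\<^sub>R A + mat 1))"

text \<open>Positivity of \<open>A\<close> leaves \<open>\<gamma> A + I\<close> with trivial kernel,
  hence invertible, and \<open>u\<close> is the resolvent applied to \<open>y\<close>. Later lemmas
  compute with \<open>u\<close> and \<open>A *v u\<close> and never touch the matrix
  inverse.\<close>

lemma yosida_resolvent:
  fixes A :: "real^'d^'d"
  assumes A: "sym_psd A" and \<gamma>: "\<gamma> > 0"
  obtains u where "y = u + \<gamma> *\<^sub>R (A *v u)" "yosida \<gamma> A *v y = A *v u"
proof -
  define R where "R = \<gamma> *\<^sub>R A + mat 1"
  have R: "R *v x = \<gamma> *\<^sub>R (A *v x) + x" for x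
    by (simp add: R_def matrix_vector_mult_add_rdistrib flip: scaleR_matrix_vector_assoc)
  have "x = 0" if "R *v x = 0" for x
  proof -
    have "0 = x \<bullet> (R *v x)" using that by simp
    also have "\<dots> = \<gamma> * (x \<bullet> (A *v x)) + x \<bullet> x"
      by (simp add: R inner_add_right)
    also have "\<dots> \<ge> x \<bullet> x"
      using A \<gamma> by (simp add: sym_psd_def)
    finally show ?thesis by (meson inner_gt_zero_iff not_le)
  qed
  then have "invertible R"
    by (meson invertible_left_inverse matrix_left_invertible_ker)
  then have "R ** matrix_inv R = mat 1"
    unfolding invertible_def matrix_inv_def by (rule someI2_ex) simp
  then have inv: "R *v (matrix_inv R *v y) = y"
    by (simp add: matrix_vector_mul_assoc)
  define u where "u = matrix_inv R *v y"
  have y: "y = u + \<gamma> *\<^sub>R (A *v u)"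
    using inv unfolding u_def[symmetric] R by (simp add: add.commute)
  moreover have "yosida \<gamma> A *v y = (1 / \<gamma>) *\<^sub>R (y - u)"
    by (simp add: yosida_def u_def R_def matrix_vector_mult_diff_rdistrib flip: scaleR_matrix_vector_assoc)
  then have "yosida \<gamma> A *v y = A *v u"
    using y \<gamma> by (simp add: algebra_simps)
  ultimately show thesis by (rule that)
qed

text \<open>With \<open>u\<close> and \<open>v\<close> the resolvents of \<open>x\<close> and
  \<open>y\<close>, both sides of the symmetry claim equal \<open>u \<bullet> (A *v v) + \<gamma> *
  ((A *v u) \<bullet> (A *v v))\<close>.\<close>

lemma sym_psd_yosida:
  fixes A :: "real^'d^'d"
  assumes A: "sym_psd A" and \<gamma>: "\<gamma> > 0"
  shows "sym_psd (yosida \<gamma> A)"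
proof (rule sym_psdI)
  have comm: "x \<bullet> (A *v y) = (A *v x) \<bullet> y" for x y
    using A by (simp add: sym_psd_def symmetric_inner_commute)
  fix x y
  obtain u where u: "x = u + \<gamma> *\<^sub>R (A *v u)" "yosida \<gamma> A *v x = A *v u"
    by (rule yosida_resolvent[OF A \<gamma>])
  obtain v where v: "y = v + \<gamma> *\<^sub>R (A *v v)" "yosida \<gamma> A *v y = A *v v"
    by (rule yosida_resolvent[OF A \<gamma>])
  show "x \<bullet> (yosida \<gamma> A *v y) = (yosida \<gamma> A *v x) \<bullet> y"
    unfolding u(2) v(2) by (subst u(1), subst v(1)) (simp add: inner_add_left inner_add_right comm
        matrix_vector_right_distrib matrix_vector_mult_scaleR)
  have "x \<bullet> (yosida \<gamma> A *v x) = u \<bullet> (A *v u) + \<gamma> * ((A *v u) \<bullet> (A *v u))"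
    unfolding u(2) by (subst u(1)) (simp add: inner_add_left)
  then show "0 \<le> x \<bullet> (yosida \<gamma> A *v x)"
    using A \<gamma> by (simp add: sym_psd_def)
qed

text \<open>The form splits into two nonnegative terms. If both vanish then
  \<open>A *v u = 0\<close>, so that \<open>x = u\<close>.\<close>

lemma yosida_inner_eq_0D:
  fixes A :: "real^'d^'d"
  assumes A: "sym_psd A" and \<gamma>: "\<gamma> > 0" and 0: "x \<bullet> (yosida \<gamma> A *v x) = 0"
  shows "A *v x = 0"
proof -
  obtain u where u: "x = u + \<gamma> *\<^sub>R (A *v u)" "yosida \<gamma> A *v x = A *v u"
    by (rule yosida_resolvent[OF A \<gamma>])
  have "x \<bullet> (yosida \<gamma> A *v x) = u \<bullet> (A *v u) + \<gamma> * ((A *v u) \<bullet> (A *v u))"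
    unfolding u(2) by (subst u(1)) (simp add: inner_add_left)
  moreover have "0 \<le> u \<bullet> (A *v u)" "0 \<le> \<gamma> * ((A *v u) \<bullet> (A *v u))"
    using A \<gamma> by (auto simp: sym_psd_def)
  ultimately have "\<gamma> * ((A *v u) \<bullet> (A *v u)) = 0"
    using 0 by linarith
  then have "A *v u = 0" using \<gamma> by simp
  with u(1) show ?thesis by simp
qed

text \<open>For \<open>q = A *v u\<close> the claim is
  \<open>(norm q)\<^sup>2 \<le> L * (u \<bullet> q)\<close> with
  \<open>\<gamma> * L * (norm q)\<^sup>2\<close> added to both sides.\<close>

lemma norm_yosida_le:
  fixes A :: "real^'d^'d"
  assumes A: "sym_psd A" and \<gamma>: "\<gamma> > 0" and L: "lambda_max A \<le> L" "0 \<le> L"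
  shows "(1 + \<gamma> * L) * (norm (yosida \<gamma> A *v x))\<^sup>2 \<le> L * (x \<bullet> (yosida \<gamma> A *v x))"
proof -
  obtain u where u: "x = u + \<gamma> *\<^sub>R (A *v u)" "yosida \<gamma> A *v x = A *v u"
    by (rule yosida_resolvent[OF A \<gamma>])
  define q where "q = A *v u"
  have sym: "transpose A = A" and nonneg: "0 \<le> u \<bullet> q"
    using A by (auto simp: sym_psd_def q_def)
  have qq: "u \<bullet> (A *v q) = (norm q)\<^sup>2"
    using symmetric_inner_commute[OF sym, of u q] by (simp add: q_def power2_norm_eq_inner)
  \<comment> \<open>Cauchy-Schwarz in the form of \<open>A\<close> at \<open>u\<close> and
    \<open>q\<close>, whose cross term is \<open>(norm q)\<^sup>2\<close> by \<open>qq\<close>.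
    After bounding \<open>q \<bullet> (A *v q)\<close>, one factor \<open>(norm q)\<^sup>2\<close>
    cancels.\<close>
  have "((norm q)\<^sup>2)\<^sup>2 \<le> (u \<bullet> q) * (q \<bullet> (A *v q))"
    using psd_cauchy_schwarz_on[OF sym subspace_UNIV, of u q] A qq by (simp add: sym_psd_def q_def)
  also have "\<dots> \<le> (u \<bullet> q) * (L * (norm q)\<^sup>2)"
    using inner_mult_le_lambda_max[OF sym, of q] mult_right_mono[OF L(1), of "(norm q)\<^sup>2"] nonneg
    by (intro mult_left_mono) auto
  finally have "(norm q)\<^sup>2 * (norm q)\<^sup>2 \<le> (L * (u \<bullet> q)) * (norm q)\<^sup>2"
    by (simp add: power2_eq_square mult_ac)
  then have "(norm q)\<^sup>2 \<le> L * (u \<bullet> q)"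
    using nonneg L(2) by (cases "q = 0") (auto intro: mult_right_le_imp_le[of _ "(norm q)\<^sup>2"])
  moreover have "x \<bullet> (yosida \<gamma> A *v x) = u \<bullet> q + \<gamma> * (norm q)\<^sup>2"
    unfolding u(2) by (subst u(1)) (simp add: inner_add_left power2_norm_eq_inner q_def)
  ultimately show ?thesis
    by (simp add: u(2) flip: q_def) (simp add: algebra_simps)
qed

section \<open>Gradients of quadratic functions\<close>

lemma grad_eqI:
  assumes "GDERIV h x :> D"
  shows "grad h x = D"
  unfolding grad_def
proof (rule the_equality, rule assms)
  fix E assume "GDERIV h x :> E"
  then have "(\<lambda>k. k \<bullet> E) = (\<lambda>k. k \<bullet> D)"
    using assms unfolding gderiv_def by (rule has_derivative_unique)
  then show "E = D" by (metis vector_eq_ldot)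
qed

lemma GDERIV_quadratic_form:
  fixes A :: "real^'d^'d"
  assumes sym: "transpose A = A"
  shows "GDERIV (\<lambda>x. 1 / 2 * ((x - a) \<bullet> (A *v (x - a)))) x :> A *v (x - a)"
proof -
  have lin: "((*v) A has_derivative (*v) A) F" for F
    by (rule bounded_linear_imp_has_derivative) (simp add: matrix_vector_mul_bounded_linear)
  have der: "((\<lambda>x. A *v (x - a)) has_derivative (*v) A) (at x)"
    by (rule has_derivative_eq_rhs[OF has_derivative_compose[OF _ lin]])
      (auto intro!: derivative_eq_intros)
  show ?thesis
    unfolding gderiv_def
    by (rule derivative_eq_intros der refl)+
      (auto simp: fun_eq_iff symmetric_inner_commute[OF sym] inner_commute)
qed

lemma grad_quadratic:
  fixes A :: "real^'d^'d"
  assumes sym: "transpose A = A"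
  shows "grad (\<lambda>z. 1 / 2 * (z \<bullet> (A *v z)) - b \<bullet> z) x = A *v x - b"
proof (rule grad_eqI, rule GDERIV_diff)
  show "GDERIV (\<lambda>z. 1 / 2 * (z \<bullet> (A *v z))) x :> A *v x"
    using GDERIV_quadratic_form[OF sym, of 0 x] by simp
  show "GDERIV (\<lambda>z. b \<bullet> z) x :> b"
    unfolding gderiv_def by (auto intro!: derivative_eq_intros simp: inner_commute)
qed

text \<open>Completing the square around the minimiser \<open>xs + u\<close> of the proximal objective, where
  \<open>u\<close> is the image of \<open>x - xs\<close> under the resolvent.\<close>

lemma proximal_objective_eq:
  fixes A :: "real^'d^'d"
  assumes sym: "transpose A = A" and \<gamma>: "\<gamma> > 0"
    and u: "x - xs = u + \<gamma> *\<^sub>R (A *v u)"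
  shows "1 / 2 * (z \<bullet> (A *v z)) - (A *v xs) \<bullet> z + 1 / (2 * \<gamma>) * (norm (z - x))\<^sup>2
    = - (1 / 2) * ((A *v xs) \<bullet> xs) + 1 / 2 * ((x - xs) \<bullet> (A *v u))
      + 1 / 2 * ((z - (xs + u)) \<bullet> (A *v (z - (xs + u)))) + 1 / (2 * \<gamma>) * (norm (z - (xs + u)))\<^sup>2"
proof -
  define w q where "w = z - (xs + u)" and "q = A *v u"
  have z: "z = xs + u + w" and zx: "z - x = w - \<gamma> *\<^sub>R q"
    using u by (simp_all add: w_def q_def algebra_simps)
  have comm: "s \<bullet> (A *v t) = t \<bullet> (A *v s)" for s t
    by (metis symmetric_inner_commute[OF sym] inner_commute)
  have "(norm (z - x))\<^sup>2 = (norm w)\<^sup>2 - 2 * \<gamma> * (w \<bullet> q) + \<gamma>\<^sup>2 * (q \<bullet> q)"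
    unfolding zx power2_norm_eq_inner by (simp add: algebra_simps inner_commute power2_eq_square)
  then have e1: "1 / (2 * \<gamma>) * (norm (z - x))\<^sup>2 = 1 / (2 * \<gamma>) * (norm w)\<^sup>2 - w \<bullet> q + \<gamma> / 2 * (q \<bullet> q)"
    using \<gamma> by (simp add: field_simps power2_eq_square)
  \<comment> \<open>The term \<open>w \<bullet> q\<close> cancels against \<open>e1\<close>; this is
    the first-order condition at \<open>xs + u\<close>.\<close>
  have e2: "1 / 2 * (z \<bullet> (A *v z)) - (A *v xs) \<bullet> z
      = - (1 / 2) * ((A *v xs) \<bullet> xs) + 1 / 2 * (u \<bullet> q) + w \<bullet> q + 1 / 2 * (w \<bullet> (A *v w))"
    unfolding z q_def
    by (simp add: inner_add_left inner_add_right matrix_vector_right_distrib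
        comm[of xs u] comm[of xs w] comm[of u w] inner_commute[of "A *v xs"] field_simps)
  have e3: "(x - xs) \<bullet> q = u \<bullet> q + \<gamma> * (q \<bullet> q)"
    by (simp add: u inner_add_left flip: q_def)
  show ?thesis
    unfolding w_def[symmetric] q_def[symmetric] e1 e2 e3 by (simp add: algebra_simps)
qed

text \<open>Writing the linear term as \<open>A *v xs\<close> makes \<open>xs\<close> a critical
  point of \<open>h\<close>, so every closed form below depends on \<open>x - xs\<close> and the
  value \<open>h xs\<close> only.\<close>

context
  fixes A :: "real^'d^'d" and xs :: "real^'d" and h :: "real^'d \<Rightarrow> real" and \<gamma> :: real
  assumes A: "sym_psd A" and \<gamma>: "\<gamma> > 0"
    and h: "h = (\<lambda>z. 1 / 2 * (z \<bullet> (A *v z)) - (A *v xs) \<bullet> z)"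
begin

lemma quadratic_at_critical_point: "h xs = - (1 / 2) * ((A *v xs) \<bullet> xs)"
  by (simp add: h inner_commute)

text \<open>By the completed square the proximal objective at \<open>z\<close> exceeds its value at
  \<open>xs + u\<close> by at least
  \<open>1 / (2 * \<gamma>) * (norm (z - (xs + u)))\<^sup>2\<close>. This yields both the infimum
  and the uniqueness of the minimiser.\<close>

lemma moreau_quadratic: "moreau \<gamma> h x = h xs + 1 / 2 * ((x - xs) \<bullet> (yosida \<gamma> A *v (x - xs)))"
  and prox_quadratic: "prox \<gamma> h x = x - \<gamma> *\<^sub>R (yosida \<gamma> A *v (x - xs))"
proof -
  obtain u where u: "x - xs = u + \<gamma> *\<^sub>R (A *v u)" "yosida \<gamma> A *v (x - xs) = A *v u"
    by (rule yosida_resolvent[OF A \<gamma>])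
  let ?m = "h xs + 1 / 2 * ((x - xs) \<bullet> (yosida \<gamma> A *v (x - xs)))"
  define G where "G z = h z + 1 / (2 * \<gamma>) * (norm (z - x))\<^sup>2" for z
  have sym: "transpose A = A" and psd: "0 \<le> z \<bullet> (A *v z)" for z
    using A by (auto simp: sym_psd_def)
  have G: "G z = ?m + 1 / 2 * ((z - (xs + u)) \<bullet> (A *v (z - (xs + u))))
      + 1 / (2 * \<gamma>) * (norm (z - (xs + u)))\<^sup>2" for z
    unfolding G_def quadratic_at_critical_point u(2)
    using proximal_objective_eq[OF sym \<gamma> u(1), of z] by (simp add: h)
  have min: "G (xs + u) = ?m" by (simp add: G)
  have lower: "?m + 1 / (2 * \<gamma>) * (norm (z - (xs + u)))\<^sup>2 \<le> G z" for z
    using psd[of "z - (xs + u)"] by (simp add: G)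
  have le: "?m \<le> G z" for z
    using lower[of z] \<gamma> by (smt (verit) zero_le_divide_1_iff zero_le_mult_iff zero_le_power2)
  have "moreau \<gamma> h x = Inf (range G)"
    by (simp add: moreau_def G_def)
  also have "\<dots> = ?m"
  proof (rule cInf_eq_minimum)
    show "?m \<in> range G" using min by (metis rangeI)
  qed (use le in blast)
  finally show "moreau \<gamma> h x = ?m" .
  define p where "p = prox \<gamma> h x"
  \<comment> \<open>Being a choice among minimisers, \<open>arg_min\<close> is known only through
    its value; the quadratic growth in \<open>lower\<close> then identifies the point.\<close>
  have "G p = G (xs + u)"
    unfolding p_def prox_def G_def[symmetric]
    using le min by (intro arg_min_equality) auto
  then have "1 / (2 * \<gamma>) * (norm (p - (xs + u)))\<^sup>2 \<le> 0"
    using lower[of p] min by simp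
  then have "p = xs + u"
    using \<gamma> by (simp add: divide_le_0_iff)
  then show "p = x - \<gamma> *\<^sub>R (yosida \<gamma> A *v (x - xs))"
    using u by (simp add: algebra_simps)
qed

lemma grad_moreau_quadratic: "grad (moreau \<gamma> h) x = yosida \<gamma> A *v (x - xs)"
proof (rule grad_eqI)
  have sym: "transpose (yosida \<gamma> A) = yosida \<gamma> A"
    using sym_psd_yosida[OF A \<gamma>] by (simp add: sym_psd_def)
  have "moreau \<gamma> h = (\<lambda>z. h xs + 1 / 2 * ((z - xs) \<bullet> (yosida \<gamma> A *v (z - xs))))"
    by (simp add: fun_eq_iff moreau_quadratic)
  then show "GDERIV (moreau \<gamma> h) x :> yosida \<gamma> A *v (x - xs)"
    using GDERIV_add[OF GDERIV_const GDERIV_quadratic_form[OF sym, of xs x], of "h xs"] by simp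
qed

lemma INF_moreau_quadratic: "(INF z. moreau \<gamma> h z) = h xs"
proof (rule cInf_eq_minimum)
  show "h xs \<in> range (moreau \<gamma> h)"
    by (rule range_eqI[of _ _ xs]) (simp add: moreau_quadratic)
  show "h xs \<le> m" if "m \<in> range (moreau \<gamma> h)" for m
    using that sym_psd_yosida[OF A \<gamma>] by (auto simp: moreau_quadratic sym_psd_def)
qed

end

section \<open>Nice sampling\<close>

lemma finite_nice_sets: "finite (nice_sets n S)"
  by (rule finite_subset[of _ "Pow {1..n}"]) (auto simp: nice_sets_def)

lemma card_nice_sets: "card (nice_sets n S) = n choose S"
  using n_subsets[of "{1..n}" S] by (simp add: nice_sets_def)

text \<open>Removing \<open>i\<close> is a bijection onto the subsets of size \<open>S - 1\<close>
  of the other indices.\<close>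

lemma card_nice_sets_containing:
  assumes i: "i \<in> {1..n}" and S: "S > 0"
  shows "card {T \<in> nice_sets n S. i \<in> T} = (n - 1) choose (S - 1)"
proof -
  let ?U = "{T. T \<subseteq> {1..n} - {i} \<and> card T = S - 1}"
  have "{T \<in> nice_sets n S. i \<in> T} = insert i ` ?U"
  proof (intro equalityI subsetI)
    fix T assume "T \<in> {T \<in> nice_sets n S. i \<in> T}"
    then have "T = insert i (T - {i})" "T - {i} \<in> ?U"
      using finite_subset[of T "{1..n}"] by (auto simp: nice_sets_def)
    then show "T \<in> insert i ` ?U" by blast
  next
    fix T assume "T \<in> insert i ` ?U"
    then obtain U where U: "T = insert i U" "U \<subseteq> {1..n} - {i}" "card U = S - 1" by auto
    then have "finite U" using finite_subset by blast
    then have "card T = S" using U S by (subst U(1), subst card_insert_disjoint) auto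
    then show "T \<in> {T \<in> nice_sets n S. i \<in> T}" using U i by (auto simp: nice_sets_def)
  qed
  moreover have "inj_on (insert i) ?U"
  proof (rule inj_onI)
    fix U V assume "U \<in> ?U" "V \<in> ?U" and eq: "insert i U = insert i V"
    then have "i \<notin> U" "i \<notin> V" by auto
    with eq show "U = V" by (simp add: insert_ident)
  qed
  ultimately show ?thesis
    using i by (simp add: card_image n_subsets)
qed

text \<open>Nice sampling is unbiased. Double counting gives each index weight
  \<open>(n - 1) choose (S - 1)\<close>, and \<open>S\<close> times \<open>n choose S\<close> is
  \<open>n\<close> times that.\<close>

lemma average_over_nice_sets:
  fixes g :: "nat \<Rightarrow> real"
  assumes S: "S \<in> {1..n}"
  shows "(\<Sum>T\<in>nice_sets n S. 1 / real S * (\<Sum>i\<in>T. g i)) / card (nice_sets n S)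
    = 1 / real n * (\<Sum>i=1..n. g i)"
proof -
  let ?N = "nice_sets n S"
  have "(\<Sum>T\<in>?N. \<Sum>i\<in>T. g i) = (\<Sum>T\<in>?N. \<Sum>i | i \<in> {1..n} \<and> i \<in> T. g i)"
    by (intro sum.cong) (auto simp: nice_sets_def)
  also have "\<dots> = (\<Sum>i=1..n. \<Sum>T | T \<in> ?N \<and> i \<in> T. g i)"
    by (rule sum.swap_restrict) (auto simp: finite_nice_sets)
  also have "\<dots> = (\<Sum>i=1..n. real ((n - 1) choose (S - 1)) * g i)"
    using S by (intro sum.cong) (auto simp: card_nice_sets_containing)
  finally have swap: "(\<Sum>T\<in>?N. \<Sum>i\<in>T. g i) = real ((n - 1) choose (S - 1)) * (\<Sum>i=1..n. g i)"
    by (simp add: sum_distrib_left)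
  have "real S * real (n choose S) = real n * real ((n - 1) choose (S - 1))"
    using times_binomial_minus1_eq[of S n] S by (metis of_nat_mult atLeastAtMost_iff less_eq_Suc_le One_nat_def)
  moreover have "0 < n choose S" using S by simp
  ultimately show ?thesis
    using S unfolding sum_distrib_left[symmetric] swap card_nice_sets
    by (simp add: field_simps)
qed

text \<open>The state after \<open>k\<close> steps is a function of the first \<open>k\<close>
  samples, which are independent of the next one, so the averaged one-step bound can be iterated.
  Passing through the history \<open>H k\<close>, which takes finitely many values on the sample
  space, settles measurability and integrability for arbitrary \<open>F\<close> and
  \<open>D\<close>.\<close>

lemma nice_sampling_contraction:
  fixes X :: "(nat \<Rightarrow> nat set) \<Rightarrow> nat \<Rightarrow> 'a" and D :: "'a \<Rightarrow> real"
  assumes sampling: "nice_sampling n S P \<S>"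
    and X_0: "\<And>Ts. X Ts 0 = x0" and X_Suc: "\<And>Ts k. X Ts (Suc k) = F (X Ts k) (Ts k)"
    and step: "\<And>x. (\<Sum>T\<in>nice_sets n S. D (F x T)) / card (nice_sets n S) \<le> \<rho> * D x"
    and \<rho>: "0 \<le> \<rho>"
  shows "prob_space.expectation P (\<lambda>\<omega>. D (X (\<lambda>j. \<S> j \<omega>) K)) \<le> \<rho> ^ K * D x0"
proof -
  let ?N = "nice_sets n S" let ?M = "\<lambda>_::nat. count_space (nice_sets n S)"
  interpret prob_space P
    using sampling by (simp add: nice_sampling_def)
  have indep: "indep_vars ?M \<S> UNIV"
    and distr: "distr P (count_space ?N) (\<S> k) = uniform_count_measure ?N" for k
    using sampling by (auto simp: nice_sampling_def)
  have meas: "\<S> k \<in> measurable P (count_space ?N)" for k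
    using indep by (auto simp: indep_vars_def)
  \<comment> \<open>Restricting to \<open>{..<k}\<close> makes the history an element of a product
    space, the form in which independence of disjoint index blocks is available.\<close>
  define H where "H k \<omega> = restrict (\<lambda>j. \<S> j \<omega>) {..<k}" for k \<omega>
  have cong: "(\<forall>j<k. Ts j = Ts' j) \<Longrightarrow> X Ts k = X Ts' k" for k Ts Ts'
    by (induction k) (auto simp: X_0 X_Suc)
  have X_H: "X (\<lambda>j. \<S> j \<omega>) k = X (H k \<omega>) k" for k \<omega>
    by (rule cong) (simp add: H_def)
  \<comment> \<open>A finite product of finite discrete spaces is discrete, so every function of the
    history is measurable.\<close>
  have PiM: "PiM {..<k} ?M = count_space ({..<k} \<rightarrow>\<^sub>E ?N)" for k
    using count_space_PiM_finite[of "{..<k}" "\<lambda>_. ?N"] finite_nice_sets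
    by (simp add: countable_finite)
  have H_meas: "H k \<in> measurable P (count_space ({..<k} \<rightarrow>\<^sub>E ?N))" for k
    unfolding H_def PiM[symmetric] by (intro measurable_restrict meas)
  have integrable_H: "integrable P (\<lambda>\<omega>. g (H k \<omega>))" for k and g :: "(nat \<Rightarrow> nat set) \<Rightarrow> real"
  proof (rule integrable_const_bound)
    show "(\<lambda>\<omega>. g (H k \<omega>)) \<in> borel_measurable P"
      by (rule measurable_compose[OF H_meas]) simp
    have "finite ({..<k} \<rightarrow>\<^sub>E ?N)"
      by (intro finite_PiE) (auto simp: finite_nice_sets)
    then have "norm (g h) \<le> (\<Sum>h\<in>{..<k} \<rightarrow>\<^sub>E ?N. norm (g h))" if "h \<in> {..<k} \<rightarrow>\<^sub>E ?N" for h
      using that by (intro member_le_sum) auto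
    then show "AE \<omega> in P. norm (g (H k \<omega>)) \<le> (\<Sum>h\<in>{..<k} \<rightarrow>\<^sub>E ?N. norm (g h))"
      using measurable_space[OF H_meas, unfolded space_count_space] by (intro AE_I2) blast
  qed
  have integrable_ind: "integrable P (\<lambda>\<omega>. indicator {T} (\<S> k \<omega>) :: real)" for k T
  proof (rule integrable_const_bound[where B = 1])
    show "(\<lambda>\<omega>. indicator {T} (\<S> k \<omega>) :: real) \<in> borel_measurable P"
      by (rule measurable_compose[OF meas]) simp
  qed (simp add: indicator_def)
  have prob_eq: "expectation (\<lambda>\<omega>. indicator {T} (\<S> k \<omega>)) = (1 / card ?N :: real)" if "T \<in> ?N" for k T
  proof -
    have "expectation (\<lambda>\<omega>. indicator {T} (\<S> k \<omega>)) = (\<integral>U. indicator {T} U \<partial>uniform_count_measure ?N :: real)"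
      unfolding distr[of k, symmetric] by (subst integral_distr[OF meas]) auto
    also have "\<dots> = 1 / card ?N"
      using that finite_nice_sets
      by (simp add: integral_uniform_count_measure indicator_def of_bool_def)
    finally show ?thesis .
  qed
  have factor: "expectation (\<lambda>\<omega>. indicator {T} (\<S> k \<omega>) * g (H k \<omega>))
      = 1 / card ?N * expectation (\<lambda>\<omega>. g (H k \<omega>))"
    (is "?lhs = _") if "T \<in> ?N" for k T and g :: "(nat \<Rightarrow> nat set) \<Rightarrow> real"
  proof -
    \<comment> \<open>The index blocks \<open>{k}\<close> and \<open>{..<k}\<close> are
      disjoint.\<close>
    have "indep_var borel ((\<lambda>h. indicator {T} (h k)) \<circ> (\<lambda>\<omega>. restrict (\<lambda>j. \<S> j \<omega>) {k}))
        borel (g \<circ> (\<lambda>\<omega>. restrict (\<lambda>j. \<S> j \<omega>) {..<k}))"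
    proof (rule indep_var_compose[OF indep_var_restrict[OF indep]])
      show "(\<lambda>h. indicator {T} (h k) :: real) \<in> borel_measurable (PiM {k} ?M)"
        by (rule measurable_compose[OF measurable_component_singleton]) auto
      show "g \<in> borel_measurable (PiM {..<k} ?M)"
        unfolding PiM by simp
    qed auto
    then have "indep_var borel (\<lambda>\<omega>. indicator {T} (\<S> k \<omega>) :: real) borel (\<lambda>\<omega>. g (H k \<omega>))"
      by (simp add: comp_def H_def)
    then have "?lhs = expectation (\<lambda>\<omega>. indicator {T} (\<S> k \<omega>)) * expectation (\<lambda>\<omega>. g (H k \<omega>))"
      by (rule indep_var_lebesgue_integral) (rule integrable_ind integrable_H)+
    then show ?thesis by (simp add: prob_eq[OF that])
  qed
  have decrease: "expectation (\<lambda>\<omega>. D (X (H (Suc k) \<omega>) (Suc k))) \<le> \<rho> * expectation (\<lambda>\<omega>. D (X (H k \<omega>) k))"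
    for k
  proof -
    let ?Z = "\<lambda>T \<omega>. D (F (X (H k \<omega>) k) T)"
    have Z: "integrable P (?Z T)" for T
      using integrable_H[of "\<lambda>h. D (F (X h k) T)"] .
    have IZ: "integrable P (\<lambda>\<omega>. indicator {T} (\<S> k \<omega>) * ?Z T \<omega>)" for T
    proof (rule Bochner_Integration.integrable_bound[OF Z[of T]])
      show "(\<lambda>\<omega>. indicator {T} (\<S> k \<omega>) * ?Z T \<omega>) \<in> borel_measurable P"
        using integrable_ind Z by (intro borel_measurable_times borel_measurable_integrable)
      show "AE \<omega> in P. norm (indicator {T} (\<S> k \<omega>) * ?Z T \<omega>) \<le> norm (?Z T \<omega>)"
        by (simp add: indicator_def)
    qed
    have Z_factor: "expectation (\<lambda>\<omega>. indicator {T} (\<S> k \<omega>) * ?Z T \<omega>)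
        = 1 / card ?N * expectation (?Z T)" if "T \<in> ?N" for T
      using factor[OF that, of k "\<lambda>h. D (F (X h k) T)"] .
    \<comment> \<open>Split by the value of the new sample: only the summand with
      \<open>T = \<S> k \<omega>\<close> survives. Each summand is then an indicator of the new
      sample times a function of the history.\<close>
    have "expectation (\<lambda>\<omega>. D (X (H (Suc k) \<omega>) (Suc k)))
        = expectation (\<lambda>\<omega>. \<Sum>T\<in>?N. indicator {T} (\<S> k \<omega>) * ?Z T \<omega>)"
    proof (rule Bochner_Integration.integral_cong[OF refl])
      fix \<omega> assume "\<omega> \<in> space P"
      then have "\<S> k \<omega> \<in> ?N"
        using measurable_space[OF meas] by simp
      then have "(\<Sum>T\<in>?N. indicator {T} (\<S> k \<omega>) * ?Z T \<omega>) = ?Z (\<S> k \<omega>) \<omega>"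
        using sum.delta[OF finite_nice_sets[of n S], of "\<S> k \<omega>" "\<lambda>T. ?Z T \<omega>"]
        by (simp add: indicator_def of_bool_def mult_delta_left eq_commute cong: if_cong)
      moreover have "X (H (Suc k) \<omega>) (Suc k) = F (X (H k \<omega>) k) (\<S> k \<omega>)"
        using X_Suc[of "\<lambda>j. \<S> j \<omega>" k] by (simp only: X_H)
      ultimately show "D (X (H (Suc k) \<omega>) (Suc k)) = (\<Sum>T\<in>?N. indicator {T} (\<S> k \<omega>) * ?Z T \<omega>)"
        by simp
    qed
    also have "\<dots> = (\<Sum>T\<in>?N. 1 / card ?N * expectation (?Z T))"
      by (subst Bochner_Integration.integral_sum[OF IZ])
        (intro sum.cong refl Z_factor)
    also have "\<dots> = expectation (\<lambda>\<omega>. (\<Sum>T\<in>?N. ?Z T \<omega>) / card ?N)"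
      using Z by (simp add: Bochner_Integration.integral_sum sum_divide_distrib)
    also have "\<dots> \<le> expectation (\<lambda>\<omega>. \<rho> * D (X (H k \<omega>) k))"
      by (intro integral_mono step integrable_H[of "\<lambda>h. (\<Sum>T\<in>?N. D (F (X h k) T)) / card ?N"]
          integrable_H[of "\<lambda>h. \<rho> * D (X h k)"])
    finally show ?thesis by simp
  qed
  have "expectation (\<lambda>\<omega>. D (X (H k \<omega>) k)) \<le> \<rho> ^ k * D x0" for k
  proof (induction k)
    case 0
    then show ?case by (simp add: X_0 prob_space)
  next
    case (Suc k)
    have "expectation (\<lambda>\<omega>. D (X (H (Suc k) \<omega>) (Suc k))) \<le> \<rho> * expectation (\<lambda>\<omega>. D (X (H k \<omega>) k))"
      by (rule decrease)
    also have "\<dots> \<le> \<rho> * (\<rho> ^ k * D x0)"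
      using Suc \<rho> by (rule mult_left_mono)
    finally show ?case by simp
  qed
  then show ?thesis by (simp add: X_H)
qed

section \<open>Convergence of FedExProx\<close>

lemma lambda_max_nonneg:
  fixes A :: "real^'d^'d"
  assumes "sym_psd A"
  shows "0 \<le> lambda_max A"
proof -
  obtain v :: "real^'d" where "norm v = 1"
    using vector_choose_size[of 1] by auto
  moreover have "0 \<le> v \<bullet> (A *v v)" "v \<bullet> (A *v v) \<le> lambda_max A * (norm v)\<^sup>2"
    using assms inner_mult_le_lambda_max[of A v] by (auto simp: sym_psd_def)
  ultimately show ?thesis by simp
qed

lemma sum_matrix_vector_mult:
  fixes B :: "'i \<Rightarrow> real^'d^'d"
  shows "(\<Sum>i\<in>I. B i) *v x = (\<Sum>i\<in>I. B i *v x)"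
  by (induction I rule: infinite_finite_induct) (auto simp: matrix_vector_mult_add_rdistrib)

text \<open>Convexity of the squared norm: the triangle inequality, then Cauchy-Schwarz for the sum
  of norms. It is the reason why the GraDS step is at least 1.\<close>

lemma norm_average_le:
  fixes g :: "'i \<Rightarrow> 'a::real_inner"
  assumes "card T = S"
  shows "(norm ((1 / real S) *\<^sub>R (\<Sum>i\<in>T. g i)))\<^sup>2 \<le> 1 / real S * (\<Sum>i\<in>T. (norm (g i))\<^sup>2)"
proof (cases "S = 0")
  case False
  have "(norm (\<Sum>i\<in>T. g i))\<^sup>2 \<le> (\<Sum>i\<in>T. norm (g i))\<^sup>2"
    by (intro power_mono norm_sum) auto
  also have "\<dots> \<le> (\<Sum>i\<in>T. (norm (g i))\<^sup>2) * real S"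
    using sum_squared_le_sum_of_squares[of "\<lambda>i. norm (g i)" T] assms by simp
  finally show ?thesis
    using False by (simp add: power_divide divide_simps power2_eq_square mult_ac)
qed simp

text \<open>Interpolation is built into \<open>f\<close>: with linear terms
  \<open>A i *v xs\<close>, the point \<open>xs\<close> is critical for every
  \<open>f i\<close>.\<close>

locale interpolated_quadratics =
  fixes n S :: nat and A :: "nat \<Rightarrow> real^'d^'d" and f :: "nat \<Rightarrow> real^'d \<Rightarrow> real"
    and \<gamma> :: real and xs :: "real^'d"
  assumes psd: "\<And>i. i \<in> {1..n} \<Longrightarrow> sym_psd (A i)"
    and nonzero: "\<exists>i\<in>{1..n}. A i \<noteq> 0"
    and gamma: "\<gamma> > 0"
    and S: "S \<in> {1..n}"
    and f: "\<And>i. i \<in> {1..n} \<Longrightarrow> f i = (\<lambda>z. 1 / 2 * (z \<bullet> (A i *v z)) - (A i *v xs) \<bullet> z)"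
begin

abbreviation "Q i \<equiv> yosida \<gamma> (A i)"
abbreviation "sols \<equiv> solutions n f"
abbreviation "g \<equiv> avg_moreau_grad \<gamma> S f"

lemma solutions_eq: "sols = {x. \<forall>i\<in>{1..n}. A i *v x = A i *v xs}"
proof -
  have "grad (f i) x = A i *v x - A i *v xs" if "i \<in> {1..n}" for i x
    unfolding f[OF that] using psd[OF that] by (intro grad_quadratic) (simp add: sym_psd_def)
  then show ?thesis by (simp add: solutions_def)
qed

lemma closed_solutions: "closed sols"
proof -
  have "sols = (\<Inter>i\<in>{1..n}. {x. A i *v x = A i *v xs})"
    by (auto simp: solutions_eq)
  then show ?thesis
    by (simp add: closed_INT closed_Collect_eq matrix_vector_mult_linear_continuous_on)
qed

lemma convex_solutions: "convex sols"
  unfolding solutions_eq convex_def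
  by (auto simp: matrix_vector_right_distrib matrix_vector_mult_scaleR simp flip: scaleR_add_left)

lemma xs_in_solutions: "xs \<in> sols"
  by (simp add: solutions_eq)

text \<open>All solutions share the linear terms, so any of them can replace \<open>xs\<close> in
  the closed forms. The one needed later is the projection of the current iterate.\<close>

lemma f_at_solution:
  assumes "s \<in> sols" "i \<in> {1..n}"
  shows "f i = (\<lambda>z. 1 / 2 * (z \<bullet> (A i *v z)) - (A i *v s) \<bullet> z)"
  using assms by (simp add: f solutions_eq)

lemma yosida_psd: "i \<in> {1..n} \<Longrightarrow> sym_psd (Q i)"
  using psd gamma by (rule sym_psd_yosida)

lemmas grad_moreau = grad_moreau_quadratic[OF psd gamma f_at_solution]
lemmas prox_eq = prox_quadratic[OF psd gamma f_at_solution]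
lemmas moreau_eq = moreau_quadratic[OF psd gamma f_at_solution]
lemmas INF_moreau = INF_moreau_quadratic[OF psd gamma f_at_solution]

lemma nice_setD:
  assumes "T \<in> nice_sets n S"
  shows "card T = S" "finite T" "\<And>i. i \<in> T \<Longrightarrow> i \<in> {1..n}"
  using assms finite_subset[of T "{1..n}"] by (auto simp: nice_sets_def)

lemma avg_grad_eq:
  assumes "s \<in> sols" "T \<in> nice_sets n S"
  shows "g x T = (1 / real S) *\<^sub>R (\<Sum>i\<in>T. Q i *v (x - s))"
  using assms nice_setD[OF assms(2)] unfolding avg_moreau_grad_def
  by (intro arg_cong[where f = "\<lambda>v. (1 / real S) *\<^sub>R v"] sum.cong) (auto simp: grad_moreau)

text \<open>At \<open>y = x - s\<close> with \<open>s\<close> a solution and \<open>T\<close> a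
  sample of size \<open>S\<close>, this is twice the sampled average of the gaps between the Moreau
  envelopes at \<open>x\<close> and their infima.\<close>

definition energy :: "real^'d \<Rightarrow> nat set \<Rightarrow> real" where
  "energy y T = 1 / real S * (\<Sum>i\<in>T. y \<bullet> (Q i *v y))"

lemma energy_nonneg: "T \<in> nice_sets n S \<Longrightarrow> 0 \<le> energy y T"
  unfolding energy_def using yosida_psd nice_setD(3)
  by (intro mult_nonneg_nonneg sum_nonneg) (auto simp: sym_psd_def)

lemma inner_avg_grad:
  assumes "s \<in> sols" "T \<in> nice_sets n S"
  shows "(x - s) \<bullet> g x T = energy (x - s) T"
  by (simp add: avg_grad_eq[OF assms] energy_def inner_sum_right)

lemma M_matrix_mult: "M_matrix n A \<gamma> *v y = (1 / real n) *\<^sub>R (\<Sum>i=1..n. Q i *v y)"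
  by (simp add: M_matrix_def yosida_def sum_matrix_vector_mult flip: scaleR_matrix_vector_assoc)

lemma average_energy:
  "(\<Sum>T\<in>nice_sets n S. energy y T) / card (nice_sets n S) = y \<bullet> (M_matrix n A \<gamma> *v y)"
  unfolding energy_def average_over_nice_sets[OF S] by (simp add: M_matrix_mult inner_sum_right)

lemma M_matrix_psd: "sym_psd (M_matrix n A \<gamma>)"
proof (rule sym_psdI)
  show "x \<bullet> (M_matrix n A \<gamma> *v y) = (M_matrix n A \<gamma> *v x) \<bullet> y" for x y
    using yosida_psd
    by (simp add: M_matrix_mult inner_sum_left inner_sum_right sym_psd_def symmetric_inner_commute)
  show "0 \<le> x \<bullet> (M_matrix n A \<gamma> *v x)" for x
    using yosida_psd
    by (auto simp: M_matrix_mult inner_sum_right sym_psd_def intro!: divide_nonneg_nonneg sum_nonneg)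
qed

text \<open>On the kernel the form of \<open>M_matrix\<close> vanishes, and with it each of its
  nonnegative summands. So kernel directions are directions of the solution set.\<close>

lemma M_matrix_kernel:
  assumes "M_matrix n A \<gamma> *v v = 0" "i \<in> {1..n}"
  shows "A i *v v = 0"
proof -
  have "(\<Sum>i=1..n. Q i *v v) = 0"
    using assms by (auto simp: M_matrix_mult)
  then have "(\<Sum>i=1..n. v \<bullet> (Q i *v v)) = 0"
    by (simp flip: inner_sum_right)
  then have "v \<bullet> (Q i *v v) = 0"
    using yosida_psd assms(2) by (subst (asm) sum_nonneg_eq_0_iff) (auto simp: sym_psd_def)
  then show ?thesis
    using yosida_inner_eq_0D[OF psd gamma] assms(2) by blast
qed

section \<open>Projection onto the solution set\<close>

definition proj :: "real^'d \<Rightarrow> real^'d" where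
  "proj = closest_point sols"

lemma proj_in_solutions: "proj x \<in> sols"
  unfolding proj_def using closed_solutions xs_in_solutions by (intro closest_point_in_set) auto

lemma norm_diff_proj_le: "s \<in> sols \<Longrightarrow> (norm (x - proj x))\<^sup>2 \<le> (norm (x - s))\<^sup>2"
  unfolding proj_def using closest_point_le[OF closed_solutions, of s x]
  by (intro power_mono) (auto simp: dist_norm)

text \<open>Moving \<open>proj x\<close> by a kernel vector \<open>v\<close> or by
  \<open>- v\<close> stays in the solution set. The obtuse-angle inequality for both signs makes
  \<open>x - proj x\<close> orthogonal to \<open>v\<close>, and the Rayleigh bound off the kernel
  applies.\<close>

lemma lambda_min_le_inner_M:
  "lambda_min_nonzero (M_matrix n A \<gamma>) * (norm (x - proj x))\<^sup>2
    \<le> (x - proj x) \<bullet> (M_matrix n A \<gamma> *v (x - proj x))"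
proof (rule lambda_min_nonzero_le_inner)
  show "transpose (M_matrix n A \<gamma>) = M_matrix n A \<gamma>"
    using M_matrix_psd by (simp add: sym_psd_def)
  fix v assume "M_matrix n A \<gamma> *v v = 0"
  then have "proj x + v \<in> sols" "proj x - v \<in> sols"
    using proj_in_solutions M_matrix_kernel
    by (auto simp: solutions_eq matrix_vector_right_distrib matrix_vector_mult_diff_distrib)
  then show "(x - proj x) \<bullet> v = 0"
    using closest_point_dot[OF convex_solutions closed_solutions, of "proj x + v" x]
      closest_point_dot[OF convex_solutions closed_solutions, of "proj x - v" x]
    by (simp add: proj_def)
qed

text \<open>Some \<open>A i\<close> is nonzero, its Yosida form is positive at a suitable point, and
  a sample containing \<open>i\<close> inherits this. The witness shows that the infimum of step
  sizes runs over a nonempty set, and gives a non-solution for bounding the contraction factor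
  below.\<close>

lemma energy_pos_exists:
  obtains i x T where "i \<in> {1..n}" "A i *v (x - xs) \<noteq> 0" "T \<in> nice_sets n S" "0 < energy (x - xs) T"
proof -
  obtain i where i: "i \<in> {1..n}" "A i \<noteq> 0" using nonzero by blast
  then obtain y where y: "A i *v y \<noteq> 0"
    by (metis matrix_eq matrix_vector_mult_0)
  have "card {T \<in> nice_sets n S. i \<in> T} \<noteq> 0"
    using card_nice_sets_containing[OF i(1), of S] S by (simp add: diff_le_mono not_less)
  then obtain T where T: "T \<in> nice_sets n S" "i \<in> T"
    by (metis (mono_tags, lifting) card.empty empty_Collect_eq)
  have nonneg: "0 \<le> y \<bullet> (Q j *v y)" if "j \<in> {1..n}" for j
    using yosida_psd[OF that] by (simp add: sym_psd_def)
  have "y \<bullet> (Q i *v y) \<noteq> 0"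
    using yosida_inner_eq_0D[OF psd gamma] i(1) y by blast
  then have "0 < (\<Sum>j\<in>T. y \<bullet> (Q j *v y))"
    using nonneg nice_setD[OF T(1)] T(2) i(1) by (intro sum_pos2[of T i]) (auto simp: less_le)
  then have "0 < energy y T" using S by (simp add: energy_def)
  then show thesis using that[of i "xs + y" T] i(1) y T(1) by simp
qed

text \<open>Both rules enter through their constant \<open>c\<close> alone. In the squared norm of
  the new difference the linear term is \<open>- 2 * \<alpha> * \<gamma>\<close> times the energy;
  by \<open>step\<close> the quadratic term gives back at most \<open>2 - c\<close> of these two
  parts.\<close>

lemma expected_distance_le:
  fixes \<alpha> :: "real^'d \<Rightarrow> nat set \<Rightarrow> real"
  assumes sampling: "nice_sampling n S P \<S>" and c: "0 \<le> c"
    and \<alpha>: "\<And>x T. T \<in> nice_sets n S \<Longrightarrow> 0 \<le> \<alpha> x T"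
    and step: "\<And>x s T. s \<in> sols \<Longrightarrow> T \<in> nice_sets n S \<Longrightarrow> g x T \<noteq> 0 \<Longrightarrow>
      \<gamma> * \<alpha> x T * (norm (g x T))\<^sup>2 \<le> (2 - c) * energy (x - s) T"
  defines "D \<equiv> \<lambda>x. (norm (x - proj x))\<^sup>2"
  shows "prob_space.expectation P (\<lambda>\<omega>. D (fedexprox \<gamma> S f \<alpha> x0 (\<lambda>j. \<S> j \<omega>) K))
    \<le> (1 - inf_step \<gamma> n S f \<alpha> * \<gamma> * c * lambda_min_nonzero (M_matrix n A \<gamma>)) ^ K * D x0"
proof -
  let ?N = "nice_sets n S" and ?a = "inf_step \<gamma> n S f \<alpha>"
  let ?\<rho> = "1 - ?a * \<gamma> * c * lambda_min_nonzero (M_matrix n A \<gamma>)"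
  define F where "F x T = x + \<alpha> x T *\<^sub>R ((1 / real S) *\<^sub>R (\<Sum>i\<in>T. prox \<gamma> (f i) x) - x)" for x T
  obtain i1 x1 T1 where 1: "i1 \<in> {1..n}" "A i1 *v (x1 - xs) \<noteq> 0" "T1 \<in> ?N" "0 < energy (x1 - xs) T1"
    by (rule energy_pos_exists)
  then have "g x1 T1 \<noteq> 0"
    using inner_avg_grad[OF xs_in_solutions, of T1 x1] by auto
  \<comment> \<open>The pair \<open>x1\<close>, \<open>T1\<close> is admissible, which rules out the
    infimum of an empty set of reals.\<close>
  with 1(3) have a_nonneg: "0 \<le> ?a"
    unfolding inf_step_def using \<alpha> by (intro cInf_greatest) auto
  have a_le: "?a \<le> \<alpha> x T" if "T \<in> ?N" "g x T \<noteq> 0" for x T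
    unfolding inf_step_def using that \<alpha> by (intro cInf_lower bdd_belowI[of _ 0]) auto
  have F_eq: "F x T = x - (\<alpha> x T * \<gamma>) *\<^sub>R g x T" if T: "T \<in> ?N" for x T
  proof -
    have "(\<Sum>i\<in>T. prox \<gamma> (f i) x) = (\<Sum>i\<in>T. x - \<gamma> *\<^sub>R (Q i *v (x - xs)))"
      using nice_setD(3)[OF T] xs_in_solutions by (intro sum.cong) (auto simp: prox_eq)
    also have "\<dots> = real S *\<^sub>R x - \<gamma> *\<^sub>R (\<Sum>i\<in>T. Q i *v (x - xs))"
      using nice_setD(1)[OF T] by (simp add: sum_subtractf scaleR_sum_right sum_constant_scaleR del: sum_constant)
    finally show ?thesis
      using S by (simp add: F_def avg_grad_eq[OF xs_in_solutions T] scaleR_diff_right)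
  qed
  have one_step: "D (F x T) \<le> D x - ?a * \<gamma> * c * energy (x - proj x) T" if T: "T \<in> ?N" for x T
  proof -
    define y e where "y = x - proj x" and "e = energy y T"
    have e: "y \<bullet> g x T = e" "0 \<le> e"
      using inner_avg_grad[OF proj_in_solutions T] energy_nonneg[OF T] by (auto simp: y_def e_def)
    have "F x T - proj x = y - (\<alpha> x T * \<gamma>) *\<^sub>R g x T"
      by (simp add: F_eq[OF T] y_def)
    \<comment> \<open>The old projection is still a solution, so the distance to it bounds the new
      distance to the solution set.\<close>
    then have "D (F x T) \<le> (norm (y - (\<alpha> x T * \<gamma>) *\<^sub>R g x T))\<^sup>2"
      using norm_diff_proj_le[OF proj_in_solutions, of "F x T" x] by (simp add: D_def)
    also have "\<dots> = (norm y)\<^sup>2 - 2 * (\<alpha> x T * \<gamma>) * e + (\<alpha> x T * \<gamma>)\<^sup>2 * (norm (g x T))\<^sup>2"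
      unfolding e(1)[symmetric] power2_norm_eq_inner
      by (simp add: inner_diff_left inner_diff_right inner_commute power2_eq_square)
    also have "\<dots> \<le> (norm y)\<^sup>2 - ?a * \<gamma> * c * e"
    proof (cases "g x T = 0")
      \<comment> \<open>Such a pair is left out of the infimum, so \<open>a_le\<close> does not
        cover it; but here \<open>e = y \<bullet> g x T = 0\<close> and both sides agree.\<close>
      case True
      then show ?thesis using e by simp
    next
      case False
      have "(\<alpha> x T * \<gamma>) * (\<gamma> * \<alpha> x T * (norm (g x T))\<^sup>2) \<le> (\<alpha> x T * \<gamma>) * ((2 - c) * e)"
        using step[OF proj_in_solutions T False, of x] \<alpha>[OF T, of x] gamma
        by (intro mult_left_mono) (auto simp: e_def y_def)
      moreover have "?a * (\<gamma> * c * e) \<le> \<alpha> x T * (\<gamma> * c * e)"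
        using a_le[OF T False] gamma c e(2) by (intro mult_right_mono) auto
      ultimately show ?thesis
        by (simp add: algebra_simps power2_eq_square)
    qed
    finally show ?thesis by (simp add: D_def e_def y_def)
  qed
  have N_pos: "0 < card ?N"
    using S by (simp add: card_nice_sets)
  have contraction: "(\<Sum>T\<in>?N. D (F x T)) / card ?N \<le> ?\<rho> * D x" for x
  proof -
    let ?y = "x - proj x"
    have "(\<Sum>T\<in>?N. D (F x T)) / card ?N \<le> (\<Sum>T\<in>?N. D x - ?a * \<gamma> * c * energy ?y T) / card ?N"
      by (intro divide_right_mono sum_mono one_step) auto
    also have "\<dots> = D x - ?a * \<gamma> * c * ((\<Sum>T\<in>?N. energy ?y T) / card ?N)"
      using N_pos by (simp add: sum_subtractf diff_divide_distrib flip: sum_distrib_left)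
    also have "\<dots> = D x - ?a * \<gamma> * c * (?y \<bullet> (M_matrix n A \<gamma> *v ?y))"
      by (simp only: average_energy)
    also have "\<dots> \<le> D x - ?a * \<gamma> * c * (lambda_min_nonzero (M_matrix n A \<gamma>) * D x)"
      unfolding D_def using a_nonneg gamma c
      by (intro diff_left_mono mult_left_mono lambda_min_le_inner_M mult_nonneg_nonneg) auto
    finally show ?thesis by (simp add: algebra_simps)
  qed
  \<comment> \<open>One averaged step from a non-solution keeps \<open>D\<close> nonnegative, which forces \<open>?\<rho> \<ge> 0\<close>.\<close>
  have \<rho>: "0 \<le> ?\<rho>"
  proof -
    have "x1 \<notin> sols"
      using 1 by (auto simp: solutions_eq matrix_vector_mult_diff_distrib)
    then have "0 < D x1"
      using proj_in_solutions[of x1] by (auto simp: D_def)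
    moreover have "0 \<le> ?\<rho> * D x1"
      using contraction[of x1] by (rule order_trans[rotated]) (auto simp: D_def intro!: divide_nonneg_nonneg sum_nonneg)
    ultimately show ?thesis by (simp add: zero_le_mult_iff)
  qed
  show ?thesis
    by (rule nice_sampling_contraction[OF sampling _ _ contraction \<rho>,
          where X = "fedexprox \<gamma> S f \<alpha> x0"]) (simp_all add: F_def Let_def)
qed

section \<open>The two step-size rules\<close>

lemma grads_step_ge_1:
  assumes "T \<in> nice_sets n S" "g x T \<noteq> 0"
  shows "1 \<le> grads_step \<gamma> S f x T"
  unfolding grads_step_def
  using norm_average_le[OF nice_setD(1)[OF assms(1)], of "\<lambda>i. grad (moreau \<gamma> (f i)) x"] assms(2)
  by (subst le_divide_eq_1_pos) (simp_all add: avg_moreau_grad_def)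

text \<open>The step size times the squared norm of \<open>g x T\<close> is the sampled mean of the
  squared gradient norms, which \<open>norm_yosida_le\<close> bounds by
  \<open>L / (1 + \<gamma> * L)\<close> times the energy. Multiplied by \<gamma>, this factor is
  \<open>2 - c\<close> for \<open>c = (2 + \<gamma> * L) / (1 + \<gamma> * L)\<close>.\<close>

lemma grads_step_bound:
  assumes s: "s \<in> sols" and T: "T \<in> nice_sets n S" and g: "g x T \<noteq> 0"
  shows "\<gamma> * grads_step \<gamma> S f x T * (norm (g x T))\<^sup>2
    \<le> (2 - (2 + \<gamma> * L_max n A) / (1 + \<gamma> * L_max n A)) * energy (x - s) T"
proof -
  define L where "L = L_max n A"
  have lam: "lambda_max (A i) \<le> L" if "i \<in> {1..n}" for i
    using that unfolding L_def L_max_def by (intro Max_ge) auto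
  have L: "0 \<le> L"
    using lam[OF S] lambda_max_nonneg[OF psd[OF S]] by simp
  then have pos: "0 < 1 + \<gamma> * L"
    using gamma by (smt (verit) mult_nonneg_nonneg)
  have "grads_step \<gamma> S f x T * (norm (g x T))\<^sup>2 = 1 / real S * (\<Sum>i\<in>T. (norm (grad (moreau \<gamma> (f i)) x))\<^sup>2)"
    using g by (simp add: grads_step_def)
  also have "\<dots> = 1 / real S * (\<Sum>i\<in>T. (norm (Q i *v (x - s)))\<^sup>2)"
    using s nice_setD(3)[OF T] by (auto simp: grad_moreau intro!: sum.cong)
  also have "\<dots> \<le> 1 / real S * (\<Sum>i\<in>T. L / (1 + \<gamma> * L) * ((x - s) \<bullet> (Q i *v (x - s))))"
    using norm_yosida_le[OF psd gamma lam L] nice_setD(3)[OF T] pos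
    by (intro mult_left_mono sum_mono) (auto simp: field_simps)
  also have "\<dots> = L / (1 + \<gamma> * L) * energy (x - s) T"
    unfolding energy_def sum_distrib_left[symmetric] by simp
  finally have "\<gamma> * (grads_step \<gamma> S f x T * (norm (g x T))\<^sup>2) \<le> \<gamma> * (L / (1 + \<gamma> * L) * energy (x - s) T)"
    using gamma by (intro mult_left_mono) auto
  moreover have "2 - (2 + \<gamma> * L) / (1 + \<gamma> * L) = \<gamma> * L / (1 + \<gamma> * L)"
    using pos by (simp add: field_simps)
  ultimately show ?thesis
    by (simp add: L_def mult.assoc)
qed

text \<open>Each envelope gap is half the Yosida form at \<open>x - s\<close>. Where
  \<open>g x T\<close> is nonzero, \<gamma> times the step times its squared norm is thus exactly
  half the energy, which is the case \<open>c = 3 / 2\<close>.\<close>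

lemma stops_step_eq:
  assumes s: "s \<in> sols" and T: "T \<in> nice_sets n S"
  shows "stops_step \<gamma> S f x T = 1 / 2 * energy (x - s) T / (\<gamma> * (norm (g x T))\<^sup>2)"
proof -
  have "(\<Sum>i\<in>T. moreau \<gamma> (f i) x - (INF z. moreau \<gamma> (f i) z))
      = (\<Sum>i\<in>T. 1 / 2 * ((x - s) \<bullet> (Q i *v (x - s))))"
  proof (rule sum.cong[OF refl])
    fix i assume "i \<in> T"
    then have i: "i \<in> {1..n}" by (rule nice_setD(3)[OF T])
    show "moreau \<gamma> (f i) x - (INF z. moreau \<gamma> (f i) z) = 1 / 2 * ((x - s) \<bullet> (Q i *v (x - s)))"
      unfolding INF_moreau[OF i s i] unfolding moreau_eq[OF i s i] by simp
  qed
  also have "\<dots> = 1 / 2 * (\<Sum>i\<in>T. (x - s) \<bullet> (Q i *v (x - s)))"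
    by (simp only: sum_distrib_left)
  finally have gap: "(\<Sum>i\<in>T. moreau \<gamma> (f i) x - (INF z. moreau \<gamma> (f i) z)) = \<dots>" .
  show ?thesis
    unfolding stops_step_def energy_def gap by simp
qed

end

theorem theoremF1:
  fixes n S :: nat
    and A :: "nat \<Rightarrow> real^'d^'d"
    and b :: "nat \<Rightarrow> real^'d"
    and f :: "nat \<Rightarrow> real^'d \<Rightarrow> real"
    and \<gamma> :: real
    and x0 :: "real^'d"
    and P :: "'w measure"
    and \<S> :: "nat \<Rightarrow> 'w \<Rightarrow> nat set"
  assumes f: "\<And>i x. i \<in> {1..n} \<Longrightarrow> f i x = 1 / 2 * (x \<bullet> (A i *v x)) - b i \<bullet> x"
    and psd: "\<And>i. i \<in> {1..n} \<Longrightarrow> sym_psd (A i)"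
    and nonzero: "\<exists>i\<in>{1..n}. A i \<noteq> 0"
    and interpolation: "\<exists>xs. \<forall>i\<in>{1..n}. grad (f i) xs = 0"
    and gamma: "\<gamma> > 0"
    and S: "S \<in> {1..n}"
    and sampling: "nice_sampling n S P \<S>"
  shows
    "(\<forall>x. \<forall>T\<in>nice_sets n S. avg_moreau_grad \<gamma> S f x T \<noteq> 0 \<longrightarrow> grads_step \<gamma> S f x T \<ge> 1) \<and>
     (\<forall>K::nat.
        (let x = (\<lambda>k \<omega>. fedexprox \<gamma> S f (grads_step \<gamma> S f) x0 (\<lambda>j. \<S> j \<omega>) k);
             proj = closest_point (solutions n f)
         in prob_space.expectation P (\<lambda>\<omega>. (norm (x K \<omega> - proj (x K \<omega>)))\<^sup>2)
            \<le> (1 - inf_step \<gamma> n S f (grads_step \<gamma> S f) * \<gamma>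
                   * ((2 + \<gamma> * L_max n A) / (1 + \<gamma> * L_max n A))
                   * lambda_min_nonzero (M_matrix n A \<gamma>)) ^ K
              * (norm (x0 - proj x0))\<^sup>2)) \<and>
     (\<forall>K::nat.
        (let x = (\<lambda>k \<omega>. fedexprox \<gamma> S f (stops_step \<gamma> S f) x0 (\<lambda>j. \<S> j \<omega>) k);
             proj = closest_point (solutions n f)
         in prob_space.expectation P (\<lambda>\<omega>. (norm (x K \<omega> - proj (x K \<omega>)))\<^sup>2)
            \<le> (1 - 3 / 2 * inf_step \<gamma> n S f (stops_step \<gamma> S f) * \<gamma>
                   * lambda_min_nonzero (M_matrix n A \<gamma>)) ^ K
              * (norm (x0 - proj x0))\<^sup>2))"
proof -
  have f': "f i = (\<lambda>z. 1 / 2 * (z \<bullet> (A i *v z)) - b i \<bullet> z)" if "i \<in> {1..n}" for i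
    using f[OF that] by auto
  obtain xs where xs: "\<And>i. i \<in> {1..n} \<Longrightarrow> grad (f i) xs = 0"
    using interpolation by blast
  \<comment> \<open>The gradient at \<open>xs\<close> is \<open>A i *v xs - b i\<close>; its
    vanishing brings the problem into the form of the locale.\<close>
  have b: "b i = A i *v xs" if "i \<in> {1..n}" for i
    using xs[OF that] grad_quadratic[of "A i" "b i" xs] psd[OF that]
    unfolding f'[OF that] by (simp add: sym_psd_def)
  interpret interpolated_quadratics n S A f \<gamma> xs
    by unfold_locales (use psd nonzero gamma S f' b in auto)
  have L: "0 \<le> L_max n A"
    using lambda_max_nonneg[OF psd[OF S]] S unfolding L_max_def
    by (intro order_trans[OF _ Max_ge]) auto
  have "0 \<le> (2 + \<gamma> * L_max n A) / (1 + \<gamma> * L_max n A)"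
    using L gamma by simp
  moreover have "0 \<le> grads_step \<gamma> S f x T" for x T
    by (simp add: grads_step_def sum_nonneg)
  ultimately have grads: "prob_space.expectation P (\<lambda>\<omega>. (norm (fedexprox \<gamma> S f (grads_step \<gamma> S f) x0 (\<lambda>j. \<S> j \<omega>) K
        - proj (fedexprox \<gamma> S f (grads_step \<gamma> S f) x0 (\<lambda>j. \<S> j \<omega>) K)))\<^sup>2)
      \<le> (1 - inf_step \<gamma> n S f (grads_step \<gamma> S f) * \<gamma> * ((2 + \<gamma> * L_max n A) / (1 + \<gamma> * L_max n A))
          * lambda_min_nonzero (M_matrix n A \<gamma>)) ^ K * (norm (x0 - proj x0))\<^sup>2" for K
    by (intro expected_distance_le sampling grads_step_bound)
  have "0 \<le> stops_step \<gamma> S f x T" if "T \<in> nice_sets n S" for x T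
    using energy_nonneg[OF that] gamma by (simp add: stops_step_eq[OF xs_in_solutions that])
  moreover have "\<gamma> * stops_step \<gamma> S f x T * (norm (g x T))\<^sup>2 \<le> (2 - 3 / 2) * energy (x - s) T"
    if "s \<in> sols" "T \<in> nice_sets n S" "g x T \<noteq> 0" for x s T
    using that gamma by (simp add: stops_step_eq)
  ultimately have "prob_space.expectation P (\<lambda>\<omega>. (norm (fedexprox \<gamma> S f (stops_step \<gamma> S f) x0 (\<lambda>j. \<S> j \<omega>) K
        - proj (fedexprox \<gamma> S f (stops_step \<gamma> S f) x0 (\<lambda>j. \<S> j \<omega>) K)))\<^sup>2)
      \<le> (1 - inf_step \<gamma> n S f (stops_step \<gamma> S f) * \<gamma> * (3 / 2)
          * lambda_min_nonzero (M_matrix n A \<gamma>)) ^ K * (norm (x0 - proj x0))\<^sup>2" for K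
    by (intro expected_distance_le sampling) auto
  with grads show ?thesis
    using grads_step_ge_1 by (simp add: Let_def mult_ac flip: proj_def)
qed

end
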